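(* Let $A$ be a finite-dimensional real associative algebra with unit such that $S=\{a\in A:a^2=-1\}$ is compact and connected, let $\mathcal U\subseteq\mathbb C$ be an open domain invariant under complex conjugation, and $V=\pi(\mathcal U\times S)$. Let $f:V\to A$ be a generalized slice-regular function of the third class, with lift $\mathfrak F(z,s)=(F(z),\phi(s))$, $\phi\in\mathrm{Aut}(S)$, and let $g=\mathcal I(F):V\to A$ be the ordinary slice-regular function induced by the same stem function $F$. Then $$f=g\circ\Psi_\phi.$$ Conversely, for every ordinary slice-regular $g:V\to A$ and every $\phi\in\mathrm{Aut}(S)$, the function $g\circ\Psi_\phi$ is a generalized slice-regular function of the third class. Thus the third class is precisely $\{g\circ\Psi_\phi:\ g\text{ slice-regular},\ \phi\in\mathrm{Aut}(S)\}$.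
   Context: $S$ is a complex manifold with $T_sS=\{h\in A:sh+hs=0\}$ and complex structure $J_S(h)=sh$; $\mathrm{Aut}(S)$ is its group of holomorphic automorphisms. $\mathbb C\otimes A$ is over $\mathbb R$, with conjugation from the factor $\mathbb C$. Two maps are denoted $\pi$: $\pi(x+iy,s)=x+sy$ on $\mathbb C\times S$, and $\pi(1\otimes a+i\otimes b,s)=a+sb$ on $\mathbb C\otimes A\times S$. The map $(x+iy,s)\mapsto x+sy$ is injective on $\mathbb C_+\times S$ ($\mathbb C_+$ the open upper half plane), so every $a\in V\setminus\mathbb R$ is uniquely $\pi(z,s)$ with $z\in\mathcal U\cap\mathbb C_+$ and $s\in S$; the map $\Psi_\phi:V\to V$ is defined by $\Psi_\phi(\pi(z,s))=\pi(z,\phi(s))$ for $z\in\mathcal U\cap\mathbb C_+$, $s\in S$, and $\Psi_\phi(x)=x$ for $x\in V\cap\mathbb R$. Involutions: $\sigma(z,s)=(\bar z,-s)$ on $\mathbb C\times S$; $\tau(z\otimes a,s)=(\bar z\otimes a,-s)$ on $\mathbb C\otimes A\times S$, extended $\mathbb R$-linearly in the first component. A function $f:V\to A$ is generalized slice-regular if there is a holomorphic map $\mathfrak F:\mathcal U\times S\to\mathbb C\otimes A\times S$ with $f\circ\pi=\pi\circ\mathfrak F$ and $\mathfrak F\circ\sigma=\tau\circ\mathfrak F$. It is of the third class if $\mathfrak F$ can be taken of the form $\mathfrak F(z,s)=(F(z),\phi(s))$ with $F:\mathcal U\to\mathbb C\otimes A$ holomorphic and $\phi\in\mathrm{Aut}(S)$.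 For $F:\mathcal U\to\mathbb C\otimes A$ holomorphic with $F(\bar z)=\overline{F(z)}$ (a stem function), $\mathcal I(F)$ is the function on $V$ with $\mathcal I(F)(\pi(z,s))=\pi(F(z),s)$; the functions $\mathcal I(F)$ are the ordinary slice-regular functions on $V$.
   Formalization: In the converse and in the final description of the third class, φ is additionally required to satisfy φ(-s) = -φ(s) on S; without this the claim fails, e.g. for quaternions, U = ℂ, g = identity and a dilation φ of the Riemann sphere S. *)

theory Defs
  imports "HOL-Analysis.Analysis"
begin

text \<open>
  The algebra \<open>A\<close> is a type of sort \<open>{real_algebra_1, euclidean_space}\<close>. The inner product
  only serves to provide finite dimension and the canonical topology; no compatibility with the
  multiplication is required, so every nonzero finite-dimensional unital associative real
  algebra is covered.
\<close>

section \<open>Embedded complex manifolds and holomorphic maps\<close>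

text \<open>
  All complex manifolds here are submanifolds of a real normed space, given by the set of points,
  the tangent space at a point and the complex structure on that tangent space. The derivative
  \<open>D\<close> within the manifold is an ambient linear map of which only the restriction to the tangent
  space is determined, and only that restriction is constrained. As in \<open>holomorphic_on\<close>, complex
  differentiability at every point is required; smoothness is then automatic.
\<close>

record 'm cmfd =
  points :: "'m set"
  tangent :: "'m \<Rightarrow> 'm set"
  cstruct :: "'m \<Rightarrow> 'm \<Rightarrow> 'm"

definition holomorphic_map ::
    "'m::real_normed_vector cmfd \<Rightarrow> 'n::real_normed_vector cmfd \<Rightarrow> ('m \<Rightarrow> 'n) \<Rightarrow> bool" where
  "holomorphic_map M N f \<longleftrightarrow>
     f \<in> points M \<rightarrow> points N \<and>
     (\<forall>x\<in>points M. \<exists>D. (f has_derivative D) (at x within points M) \<and>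
        (\<forall>h\<in>tangent M x. D h \<in> tangent N (f x) \<and>
            D (cstruct M x h) = cstruct N (f x) (D h)))"

definition prod_mfd :: "'m cmfd \<Rightarrow> 'n cmfd \<Rightarrow> ('m \<times> 'n) cmfd" (infixr "\<times>\<^sub>m" 80) where
  "M \<times>\<^sub>m N =
     \<lparr> points = points M \<times> points N,
       tangent = (\<lambda>(x, y). tangent M x \<times> tangent N y),
       cstruct = (\<lambda>(x, y) (h, k). (cstruct M x h, cstruct N y k)) \<rparr>"

definition complex_domain :: "complex set \<Rightarrow> complex cmfd" where
  "complex_domain U = \<lparr> points = U, tangent = (\<lambda>_. UNIV), cstruct = (\<lambda>_ h. \<i> * h) \<rparr>"

definition imag_units :: "'a::real_algebra_1 set" where
  "imag_units = {a. a ^ 2 = - 1}"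

definition unit_mfd :: "'a::real_algebra_1 cmfd" where
  "unit_mfd =
     \<lparr> points = imag_units,
       tangent = (\<lambda>s. {h. s * h + h * s = 0}),
       cstruct = (\<lambda>s h. s * h) \<rparr>"

definition Aut_units :: "('a::{real_algebra_1,euclidean_space} \<Rightarrow> 'a) set" where
  "Aut_units = {\<phi>. bij_betw \<phi> imag_units imag_units \<and>
                   holomorphic_map unit_mfd unit_mfd \<phi> \<and>
                   holomorphic_map unit_mfd unit_mfd (inv_into imag_units \<phi>)}"

section \<open>The complexification\<close>

text \<open>
  The pair \<open>(a, b)\<close> stands for the element \<open>1 \<otimes> a + \<i> \<otimes> b\<close> of \<open>\<complex> \<otimes> A\<close> (tensor product over
  the reals); every element is uniquely of this form.
\<close>

type_synonym 'a ctensor = "'a \<times> 'a"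

definition ctensor_mfd :: "'a::real_algebra_1 ctensor cmfd" where
  "ctensor_mfd =
     \<lparr> points = UNIV, tangent = (\<lambda>_. UNIV), cstruct = (\<lambda>_ (a, b). (- b, a)) \<rparr>"

definition ctensor_cnj :: "'a::real_algebra_1 ctensor \<Rightarrow> 'a ctensor" where
  "ctensor_cnj = (\<lambda>(a, b). (a, - b))"

definition proj :: "complex \<times> 'a \<Rightarrow> 'a::real_algebra_1" where
  "proj = (\<lambda>(z, s). of_real (Re z) + s * of_real (Im z))"

definition tproj :: "'a ctensor \<times> 'a \<Rightarrow> 'a::real_algebra_1" where
  "tproj = (\<lambda>((a, b), s). a + s * b)"

definition sigma :: "complex \<times> 'a \<Rightarrow> complex \<times> 'a::real_algebra_1" where
  "sigma = (\<lambda>(z, s). (cnj z, - s))"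

definition tau :: "'a ctensor \<times> 'a \<Rightarrow> 'a ctensor \<times> 'a::real_algebra_1" where
  "tau = (\<lambda>(w, s). (ctensor_cnj w, - s))"

section \<open>Slice-regular and generalized slice-regular functions\<close>

text \<open>
  Functions on \<open>V = slice_domain U\<close> are total functions on \<open>'a\<close> of which only the values on \<open>V\<close>
  matter.
\<close>

definition slice_domain :: "complex set \<Rightarrow> 'a::real_algebra_1 set" where
  "slice_domain U = proj ` (U \<times> imag_units)"

definition gen_lift ::
    "complex set \<Rightarrow> ('a \<Rightarrow> 'a) \<Rightarrow>
     (complex \<times> 'a \<Rightarrow> 'a ctensor \<times> 'a::{real_algebra_1,euclidean_space}) \<Rightarrow> bool" where
  "gen_lift U f FF \<longleftrightarrow>
     holomorphic_map (complex_domain U \<times>\<^sub>m unit_mfd) (ctensor_mfd \<times>\<^sub>m unit_mfd) FF \<and>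
     (\<forall>p \<in> U \<times> imag_units. f (proj p) = tproj (FF p) \<and> FF (sigma p) = tau (FF p))"

definition gen_slice_regular ::
    "complex set \<Rightarrow> ('a \<Rightarrow> 'a::{real_algebra_1,euclidean_space}) \<Rightarrow> bool" where
  "gen_slice_regular U f \<longleftrightarrow> (\<exists>FF. gen_lift U f FF)"

text \<open>
  For a lift of the form \<open>(z, s) \<mapsto> (F z, \<phi> s)\<close> the symmetry \<open>FF \<circ> sigma = tau \<circ> FF\<close> says that
  \<open>F (cnj z) = ctensor_cnj (F z)\<close> and \<open>\<phi> (- s) = - \<phi> s\<close>. The latter does not hold for every
  automorphism: over the quaternions the units form the Riemann sphere, with automorphism group
  \<open>PSL(2, \<complex>)\<close>, and the automorphisms commuting with the antipodal map form the subgroup \<open>SO(3)\<close>.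
\<close>

definition third_class_lift ::
    "complex set \<Rightarrow> ('a \<Rightarrow> 'a) \<Rightarrow> (complex \<Rightarrow> 'a ctensor) \<Rightarrow>
     ('a \<Rightarrow> 'a::{real_algebra_1,euclidean_space}) \<Rightarrow> bool" where
  "third_class_lift U f F \<phi> \<longleftrightarrow>
     holomorphic_map (complex_domain U) ctensor_mfd F \<and> \<phi> \<in> Aut_units \<and>
     gen_lift U f (\<lambda>(z, s). (F z, \<phi> s))"

definition third_class ::
    "complex set \<Rightarrow> ('a \<Rightarrow> 'a::{real_algebra_1,euclidean_space}) \<Rightarrow> bool" where
  "third_class U f \<longleftrightarrow> gen_slice_regular U f \<and> (\<exists>F \<phi>. third_class_lift U f F \<phi>)"

definition stem_function ::
    "complex set \<Rightarrow> (complex \<Rightarrow> 'a::{real_algebra_1,euclidean_space} ctensor) \<Rightarrow> bool" where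
  "stem_function U F \<longleftrightarrow>
     holomorphic_map (complex_domain U) ctensor_mfd F \<and> (\<forall>z\<in>U. F (cnj z) = ctensor_cnj (F z))"

text \<open>The description of \<open>slice_fun U F\<close> is unique on \<open>V\<close> when \<open>F\<close> is a stem function.\<close>

definition slice_fun :: "complex set \<Rightarrow> (complex \<Rightarrow> 'a ctensor) \<Rightarrow> 'a \<Rightarrow> 'a::real_algebra_1" where
  "slice_fun U F a =
     (THE b. \<exists>z\<in>U. \<exists>s\<in>imag_units. a = proj (z, s) \<and> b = tproj (F z, s))"

definition slice_regular ::
    "complex set \<Rightarrow> ('a \<Rightarrow> 'a::{real_algebra_1,euclidean_space}) \<Rightarrow> bool" where
  "slice_regular U g \<longleftrightarrow>
     (\<exists>F. stem_function U F \<and> (\<forall>a\<in>slice_domain U. g a = slice_fun U F a))"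

definition Psi :: "complex set \<Rightarrow> ('a \<Rightarrow> 'a) \<Rightarrow> 'a \<Rightarrow> 'a::real_algebra_1" where
  "Psi U \<phi> a =
     (if a \<in> \<real> then a
      else (THE b. \<exists>z\<in>U. \<exists>s\<in>imag_units. Im z > 0 \<and> a = proj (z, s) \<and> b = proj (z, \<phi> s)))"

end

theory Submission
  imports Defs
begin

text \<open>
  A non-real \<open>x + s y\<close> is a root of \<open>t\<^sup>2 - 2 x t + x\<^sup>2 + y\<^sup>2\<close>, and such a quadratic polynomial is
  determined by any of its non-real roots. Hence the fibres of \<open>proj\<close> over non-real points are the
  orbits of \<open>sigma\<close>, so that slice functions are well defined and \<open>Psi\<close> maps \<open>proj (z, s)\<close> to
  \<open>proj (z, \<phi> s)\<close> for every \<open>z\<close> in \<open>U\<close> if \<open>\<phi>\<close> is odd. Both claims then amount to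
  \<open>f (proj (z, s)) = tproj (F z, \<phi> s) = slice_fun U F (proj (z, \<phi> s))\<close>.
\<close>

section \<open>Imaginary units and the fibres of \<open>proj\<close>\<close>

lemma imag_unit_not_real:
  assumes "s \<in> imag_units"
  shows "s \<notin> \<real>"
proof
  assume "s \<in> \<real>"
  then obtain r where r: "s = of_real r" by (auto elim: Reals_cases)
  with assms have "of_real (r ^ 2) = (of_real (- 1) :: 'a)"
    by (simp add: imag_units_def)
  then have "r ^ 2 = - 1" by (simp only: of_real_eq_iff)
  then show False by (smt (verit) zero_le_power2)
qed

lemma uminus_imag_units: "s \<in> imag_units \<Longrightarrow> - s \<in> imag_units"
  by (simp add: imag_units_def)

text \<open>If \<open>Im z\<close> is nonzero, subtracting \<open>Re z\<close> and dividing by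
  \<open>Im z\<close> recovers \<open>s\<close> from the point by real operations, and
  \<open>s\<close> is not real.\<close>

lemma proj_in_Reals_iff:
  assumes "s \<in> imag_units"
  shows "proj (z, s) \<in> \<real> \<longleftrightarrow> Im z = 0"
proof
  assume "proj (z, s) \<in> \<real>"
  then have "proj (z, s) - of_real (Re z) \<in> \<real>" by (intro Reals_diff) auto
  then have *: "s * of_real (Im z) \<in> \<real>" by (simp add: proj_def)
  show "Im z = 0"
  proof (rule ccontr)
    assume "Im z \<noteq> 0"
    have "s * of_real (Im z) * of_real (inverse (Im z)) \<in> \<real>"
      by (rule Reals_mult [OF * Reals_of_real])
    also have "s * of_real (Im z) * of_real (inverse (Im z)) = s"
      using \<open>Im z \<noteq> 0\<close> by (simp only: mult.assoc of_real_mult [symmetric]) simp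
    finally show False using imag_unit_not_real [OF assms] by simp
  qed
qed (simp add: proj_def)

lemma proj_sigma: "proj (sigma p) = proj p"
  by (cases p) (simp add: proj_def sigma_def)

text \<open>Real scalars are central, so the computation takes place in the copy of the complex
  numbers spanned by 1 and \<open>s\<close>, even if the algebra is not commutative.\<close>

lemma proj_square:
  assumes "s \<in> imag_units"
  shows "proj (z, s) ^ 2 = (2 * Re z) *\<^sub>R proj (z, s) - of_real ((cmod z) ^ 2)"
proof -
  have s: "s * s = - 1" using assms by (simp add: imag_units_def power2_eq_square)
  have p: "proj (z, s) = of_real (Re z) + Im z *\<^sub>R s"
    by (simp add: proj_def of_real_def)
  have n: "(cmod z) ^ 2 = Re z * Re z + Im z * Im z"
    unfolding cmod_power2 by (simp only: power2_eq_square)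
  show ?thesis
    unfolding p n mult_2 scaleR_add_left
    by (simp add: power2_eq_square algebra_simps s of_real_def)
qed

lemma proj_eq_nonreal:
  assumes s: "s \<in> imag_units" and t: "t \<in> imag_units"
    and eq: "proj (z, s) = proj (w, t)" and nz: "Im z \<noteq> 0"
  shows "(w, t) = (z, s) \<or> (w, t) = sigma (z, s)"
proof -
  have "(2 * Re z) *\<^sub>R proj (z, s) - of_real ((cmod z) ^ 2)
      = (2 * Re w) *\<^sub>R proj (z, s) - of_real ((cmod w) ^ 2)"
    using proj_square [OF s, of z] proj_square [OF t, of w] eq by simp
  \<comment> \<open>The difference of the two quadratic relations is linear in the point, with real
    coefficients. A nonzero leading coefficient would make the point real.\<close>
  then have *: "(2 * Re z - 2 * Re w) *\<^sub>R proj (z, s) = of_real ((cmod z) ^ 2 - (cmod w) ^ 2)"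
    by (simp add: algebra_simps)
  have re: "Re z = Re w"
  proof (rule ccontr)
    assume "Re z \<noteq> Re w"
    then have "proj (z, s)
        = inverse (2 * Re z - 2 * Re w) *\<^sub>R ((2 * Re z - 2 * Re w) *\<^sub>R proj (z, s))"
      by simp
    also have "\<dots> \<in> \<real>" unfolding * unfolding scaleR_conv_of_real by (intro Reals_mult Reals_of_real)
    finally show False using proj_in_Reals_iff [OF s] nz by blast
  qed
  then have "of_real ((cmod z) ^ 2 - (cmod w) ^ 2) = (0 :: 'a)" using * by simp
  then have "(cmod z) ^ 2 = (cmod w) ^ 2" by (simp only: of_real_eq_0_iff)
  then have "(Im z) ^ 2 = (Im w) ^ 2" using re by (simp add: cmod_power2)
  then consider "Im w = Im z" | "Im w = - Im z" by (auto simp: power2_eq_iff)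
  then show ?thesis
  proof cases
    case 1
    then have "Im z *\<^sub>R s = Im z *\<^sub>R t" using eq re by (simp add: proj_def of_real_def)
    then have "s = t" using nz by simp
    then show ?thesis using 1 re by (simp add: complex_eq_iff)
  next
    case 2
    then have "(s + t) * of_real (Im z) = 0" using eq re by (simp add: proj_def algebra_simps)
    \<comment> \<open>The algebra may have zero divisors, so the factor is cancelled as a
      scalar.\<close>
    then have "Im z *\<^sub>R (s + t) = 0" by (simp add: of_real_def)
    then have "t = - s" using nz by (simp add: eq_neg_iff_add_eq_0 add.commute)
    then show ?thesis using 2 re by (simp add: sigma_def complex_eq_iff)
  qed
qed

text \<open>Over a real point the unit is arbitrary and only the complex coordinate is determined.
  This suffices for slice functions, since the value of a stem function at a real point has no
  imaginary component.\<close>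

lemma proj_real_fibre:
  assumes s: "s \<in> imag_units" and t: "t \<in> imag_units"
    and eq: "proj (z, s) = proj (w, t)" and "Im z = 0"
  shows "w = z"
proof -
  have "Im w = 0"
    using assms proj_in_Reals_iff [OF s, of z] proj_in_Reals_iff [OF t, of w] by simp
  with eq \<open>Im z = 0\<close> show ?thesis by (simp add: proj_def complex_eq_iff)
qed

section \<open>Values of slice functions and of \<open>Psi\<close>\<close>

lemma stem_function_real:
  assumes "stem_function U F" "z \<in> U" "Im z = 0"
  shows "snd (F z) = 0"
proof -
  have "cnj z = z" using assms by (simp add: complex_eq_iff)
  with assms have "F z = ctensor_cnj (F z)" by (metis stem_function_def)
  then have "snd (F z) = - snd (F z)" by (cases "F z") (simp add: ctensor_cnj_def)
  then have "2 *\<^sub>R snd (F z) = 0" by (simp add: scaleR_2 eq_neg_iff_add_eq_0)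
  then show ?thesis by simp
qed

lemma slice_fun_proj:
  assumes F: "stem_function U F" and z: "z \<in> U" and s: "s \<in> imag_units"
  shows "slice_fun U F (proj (z, s)) = tproj (F z, s)"
  unfolding slice_fun_def
proof (rule the_equality)
  show "\<exists>w\<in>U. \<exists>t\<in>imag_units. proj (z, s) = proj (w, t) \<and> tproj (F z, s) = tproj (F w, t)"
    using z s by blast
next
  fix b
  assume "\<exists>w\<in>U. \<exists>t\<in>imag_units. proj (z, s) = proj (w, t) \<and> b = tproj (F w, t)"
  then obtain w t where w: "w \<in> U" and t: "t \<in> imag_units"
    and eq: "proj (z, s) = proj (w, t)" and b: "b = tproj (F w, t)" by blast
  show "b = tproj (F z, s)"
  proof (cases "Im z = 0")
    case True
    then show ?thesis
      using b proj_real_fibre [OF s t eq] stem_function_real [OF F z]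
      by (simp add: tproj_def case_prod_beta)
  next
    case False
    \<comment> \<open>Passing to \<open>sigma (z, s)\<close> changes the sign of both the second
      component \<open>b\<close> of \<open>F z\<close> and the unit \<open>s\<close>, so that
      \<open>a + s * b\<close> stays the same.\<close>
    have "F (cnj z) = ctensor_cnj (F z)" using F z by (simp add: stem_function_def)
    then show ?thesis
      using proj_eq_nonreal [OF s t eq False] b
      by (auto simp: sigma_def tproj_def ctensor_cnj_def case_prod_beta)
  qed
qed

text \<open>Since \<open>sigma\<close> reverses the sign of the imaginary part, a non-real point has
  at most one representative in the upper half plane, so the description in \<open>Psi\<close> is
  unique.\<close>

lemma Psi_proj_upper:
  assumes z: "z \<in> U" and s: "s \<in> imag_units" and pos: "Im z > 0"
  shows "Psi U \<phi> (proj (z, s)) = proj (z, \<phi> s)"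
proof -
  have "(THE b. \<exists>w\<in>U. \<exists>t\<in>imag_units. Im w > 0 \<and> proj (z, s) = proj (w, t) \<and> b = proj (w, \<phi> t))
      = proj (z, \<phi> s)"
  proof (rule the_equality)
    show "\<exists>w\<in>U. \<exists>t\<in>imag_units. Im w > 0 \<and> proj (z, s) = proj (w, t)
        \<and> proj (z, \<phi> s) = proj (w, \<phi> t)"
      using assms by blast
  next
    fix b
    assume "\<exists>w\<in>U. \<exists>t\<in>imag_units. Im w > 0 \<and> proj (z, s) = proj (w, t) \<and> b = proj (w, \<phi> t)"
    then show "b = proj (z, \<phi> s)"
      using proj_eq_nonreal [OF s, of _ z] pos by (fastforce simp: sigma_def)
  qed
  then show ?thesis using proj_in_Reals_iff [OF s, of z] pos by (simp add: Psi_def)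
qed

lemma Psi_proj:
  assumes U: "cnj ` U = U" and z: "z \<in> U" and s: "s \<in> imag_units"
    and odd: "\<phi> (- s) = - \<phi> s"
  shows "Psi U \<phi> (proj (z, s)) = proj (z, \<phi> s)"
proof -
  consider "Im z = 0" | "Im z > 0" | "Im z < 0" by linarith
  then show ?thesis
  proof cases
    case 1
    then show ?thesis using proj_in_Reals_iff [OF s, of z] by (simp add: Psi_def) (simp add: proj_def)
  next
    case 2
    then show ?thesis using Psi_proj_upper z s by blast
  next
    case 3
    \<comment> \<open>The same point is represented by \<open>sigma (z, s)\<close>, which lies over
      the upper half plane. Oddness of \<open>\<phi>\<close> allows \<open>sigma\<close> to be moved
      past \<open>\<phi>\<close>.\<close>
    have "cnj z \<in> U" using U z by blast
    then have "Psi U \<phi> (proj (sigma (z, s))) = proj (cnj z, \<phi> (- s))"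
      using 3 uminus_imag_units [OF s] by (simp add: sigma_def Psi_proj_upper)
    also have "\<dots> = proj (sigma (z, \<phi> s))" by (simp add: sigma_def odd)
    finally show ?thesis by (simp add: proj_sigma)
  qed
qed

section \<open>The identity and products as holomorphic maps\<close>

lemma id_in_Aut_units: "id \<in> Aut_units"
proof -
  \<comment> \<open>Agreement with the identity is asked only on the units, so that the claim also
    covers \<open>inv_into imag_units id\<close>.\<close>
  have "holomorphic_map unit_mfd unit_mfd f" if "\<And>s. s \<in> imag_units \<Longrightarrow> f s = s"
    for f :: "'a \<Rightarrow> 'a"
    unfolding holomorphic_map_def
  proof (intro conjI ballI)
    show "f \<in> points unit_mfd \<rightarrow> points unit_mfd" using that by (auto simp: unit_mfd_def)
    fix s :: 'a
    assume "s \<in> points unit_mfd"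
    then have s: "s \<in> imag_units" by (simp add: unit_mfd_def)
    have "(f has_derivative (\<lambda>h. h)) (at s within imag_units)"
      by (rule has_derivative_transform [OF s that has_derivative_ident]) simp
    then show "\<exists>D. (f has_derivative D) (at s within points unit_mfd) \<and>
        (\<forall>h\<in>tangent unit_mfd s. D h \<in> tangent unit_mfd (f s) \<and>
          D (cstruct unit_mfd s h) = cstruct unit_mfd (f s) (D h))"
      using that [OF s] by (intro exI [of _ "\<lambda>h. h"]) (simp add: unit_mfd_def)
  qed
  moreover have "inv_into imag_units id s = s" if "s \<in> imag_units" for s :: 'a
    using inv_into_f_f [of id imag_units s] that by simp
  ultimately show ?thesis by (simp add: Aut_units_def)
qed

lemma holomorphic_map_prod:
  assumes f: "holomorphic_map M M' f" and g: "holomorphic_map N N' g"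
  shows "holomorphic_map (M \<times>\<^sub>m N) (M' \<times>\<^sub>m N') (\<lambda>(x, y). (f x, g y))"
  unfolding holomorphic_map_def
proof (intro conjI ballI)
  show "(\<lambda>(x, y). (f x, g y)) \<in> points (M \<times>\<^sub>m N) \<rightarrow> points (M' \<times>\<^sub>m N')"
    using f g by (auto simp: holomorphic_map_def prod_mfd_def)
  fix p
  assume "p \<in> points (M \<times>\<^sub>m N)"
  then obtain x y where p: "p = (x, y)" and x: "x \<in> points M" and y: "y \<in> points N"
    by (auto simp: prod_mfd_def)
  from f x obtain D where D: "(f has_derivative D) (at x within points M)"
      "\<And>h. h \<in> tangent M x \<Longrightarrow>
        D h \<in> tangent M' (f x) \<and> D (cstruct M x h) = cstruct M' (f x) (D h)"
    by (fastforce simp: holomorphic_map_def)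
  from g y obtain E where E: "(g has_derivative E) (at y within points N)"
      "\<And>h. h \<in> tangent N y \<Longrightarrow>
        E h \<in> tangent N' (g y) \<and> E (cstruct N y h) = cstruct N' (g y) (E h)"
    by (fastforce simp: holomorphic_map_def)
  \<comment> \<open>The projection maps the product into the factor, and the derivative within the
    factor restricts to the image.\<close>
  have "((\<lambda>q. f (fst q)) has_derivative (\<lambda>h. D (fst h))) (at p within points M \<times> points N)"
    by (rule has_derivative_in_compose [OF has_derivative_fst [OF has_derivative_ident]])
      (use D(1) p in \<open>auto intro: has_derivative_subset\<close>)
  moreover have "((\<lambda>q. g (snd q)) has_derivative (\<lambda>h. E (snd h))) (at p within points M \<times> points N)"
    by (rule has_derivative_in_compose [OF has_derivative_snd [OF has_derivative_ident]])
      (use E(1) p in \<open>auto intro: has_derivative_subset\<close>)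
  ultimately have "((\<lambda>(x, y). (f x, g y)) has_derivative (\<lambda>h. (D (fst h), E (snd h))))
      (at p within points M \<times> points N)"
    unfolding case_prod_beta' by (rule has_derivative_Pair)
  then show "\<exists>D. ((\<lambda>(x, y). (f x, g y)) has_derivative D) (at p within points (M \<times>\<^sub>m N)) \<and>
      (\<forall>h\<in>tangent (M \<times>\<^sub>m N) p. D h \<in> tangent (M' \<times>\<^sub>m N') (case p of (x, y) \<Rightarrow> (f x, g y)) \<and>
        D (cstruct (M \<times>\<^sub>m N) p h)
          = cstruct (M' \<times>\<^sub>m N') (case p of (x, y) \<Rightarrow> (f x, g y)) (D h))"
    using D(2) E(2)
    by (intro exI [of _ "\<lambda>h. (D (fst h), E (snd h))"])
      (auto simp: prod_mfd_def p)
qed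

section \<open>The third class and compositions with \<open>Psi\<close>\<close>

lemma third_class_liftD:
  fixes f :: "'a::{real_algebra_1,euclidean_space} \<Rightarrow> 'a"
  assumes "third_class_lift U f F \<phi>" "z \<in> U" "s \<in> (imag_units :: 'a set)"
  shows "f (proj (z, s)) = tproj (F z, \<phi> s)" "F (cnj z) = ctensor_cnj (F z)" "\<phi> (- s) = - \<phi> s"
  using assms by (auto simp: third_class_lift_def gen_lift_def sigma_def tau_def)

text \<open>The symmetry of the lift is a condition on pairs; the unit \<open>s\<close> completes
  each \<open>z\<close> to a pair, from which the first component gives the symmetry of
  \<open>F\<close>.\<close>

lemma third_class_lift_stem_function:
  fixes f :: "'a::{real_algebra_1,euclidean_space} \<Rightarrow> 'a"
  assumes "third_class_lift U f F \<phi>" "s \<in> (imag_units :: 'a set)"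
  shows "stem_function U F"
  using assms third_class_liftD(2) [OF assms(1) _ assms(2)]
  by (simp add: stem_function_def third_class_lift_def)

lemma Aut_units_in: "\<phi> \<in> Aut_units \<Longrightarrow> s \<in> imag_units \<Longrightarrow> \<phi> s \<in> imag_units"
  by (auto simp: Aut_units_def bij_betw_def)

lemma third_class_lift_slice_regular:
  fixes f :: "'a::{real_algebra_1,euclidean_space} \<Rightarrow> 'a"
  assumes "third_class_lift U f F \<phi>"
  shows "slice_regular U (slice_fun U F :: 'a \<Rightarrow> 'a)"
proof (cases "(imag_units :: 'a set) = {}")
  case True
  \<comment> \<open>Without imaginary units the lift need not be symmetric, but the domain is empty and any stem
    function will do.\<close>
  have "stem_function U (\<lambda>_. 0 :: 'a ctensor)"
    by (auto simp: stem_function_def holomorphic_map_def complex_domain_def ctensor_mfd_def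
        ctensor_cnj_def intro!: exI [of _ "\<lambda>_. 0"] split: prod.split)
      (simp_all add: zero_prod_def)
  then show ?thesis using True by (auto simp: slice_regular_def slice_domain_def)
next
  case False
  then show ?thesis
    using third_class_lift_stem_function [OF assms] by (auto simp: slice_regular_def)
qed

lemma third_class_lift_eq_slice_fun_Psi:
  assumes lift: "third_class_lift U f F \<phi>" and U: "cnj ` U = U" and a: "a \<in> slice_domain U"
  shows "f a = slice_fun U F (Psi U \<phi> a)"
proof -
  from a obtain z s where z: "z \<in> U" and s: "s \<in> imag_units" and a: "a = proj (z, s)"
    by (auto simp: slice_domain_def)
  have \<phi>: "\<phi> s \<in> imag_units"
    using lift s by (simp add: third_class_lift_def Aut_units_in)
  show ?thesis
    unfolding a Psi_proj [OF U z s third_class_liftD(3) [OF lift z s]]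
      slice_fun_proj [OF third_class_lift_stem_function [OF lift s] z \<phi>]
    by (rule third_class_liftD(1) [OF lift z s])
qed

text \<open>A stem function \<open>F\<close> of \<open>g\<close> and the automorphism form the lift:
  its symmetry combines that of \<open>F\<close> with oddness of \<open>\<phi>\<close>. The function
  \<open>f\<close> is kept separate because it agrees with the composition only on
  \<open>slice_domain U\<close>, as in the description of the whole class.\<close>

lemma third_class_slice_regular_Psi:
  fixes f g :: "'a::{real_algebra_1,euclidean_space} \<Rightarrow> 'a"
  assumes g: "slice_regular U g" and \<phi>: "\<phi> \<in> Aut_units"
    and odd: "\<And>s. s \<in> imag_units \<Longrightarrow> \<phi> (- s) = - \<phi> s" and U: "cnj ` U = U"
    and f: "\<And>a. a \<in> slice_domain U \<Longrightarrow> f a = g (Psi U \<phi> a)"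
  shows "third_class U f"
proof -
  obtain F where F: "stem_function U F"
    and gF: "\<And>a. a \<in> slice_domain U \<Longrightarrow> g a = slice_fun U F a"
    using g by (auto simp: slice_regular_def)
  have "f (proj (z, s)) = tproj (F z, \<phi> s)" if z: "z \<in> U" and s: "s \<in> imag_units" for z s
  proof -
    have \<phi>s: "\<phi> s \<in> imag_units" using \<phi> s by (rule Aut_units_in)
    have "f (proj (z, s)) = g (proj (z, \<phi> s))"
      using z s by (simp add: f slice_domain_def Psi_proj [OF U z s odd [OF s]])
    \<comment> \<open>The point stays in \<open>slice_domain U\<close> because \<open>\<phi>\<close>
      preserves the units.\<close>
    also have "\<dots> = slice_fun U F (proj (z, \<phi> s))"
      using z \<phi>s by (simp add: gF slice_domain_def)
    also have "\<dots> = tproj (F z, \<phi> s)" by (rule slice_fun_proj [OF F z \<phi>s])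
    finally show ?thesis .
  qed
  moreover have "holomorphic_map (complex_domain U \<times>\<^sub>m unit_mfd) (ctensor_mfd \<times>\<^sub>m unit_mfd)
      (\<lambda>(z, s). (F z, \<phi> s))"
    using F \<phi> by (intro holomorphic_map_prod) (auto simp: stem_function_def Aut_units_def)
  ultimately have "gen_lift U f (\<lambda>(z, s). (F z, \<phi> s))"
    using F odd by (auto simp: gen_lift_def sigma_def tau_def stem_function_def)
  then show ?thesis
    using F \<phi> by (auto simp: third_class_def gen_slice_regular_def third_class_lift_def
        stem_function_def)
qed

lemma third_class_imp_slice_regular_Psi:
  fixes f :: "'a::{real_algebra_1,euclidean_space} \<Rightarrow> 'a"
  assumes f: "third_class U f" and U: "cnj ` U = U"
  shows "\<exists>g \<phi>. slice_regular U g \<and> \<phi> \<in> Aut_units \<and>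
    (\<forall>s\<in>imag_units. \<phi> (- s) = - \<phi> s) \<and> (\<forall>a\<in>slice_domain U. f a = g (Psi U \<phi> a))"
proof -
  obtain F \<phi> where lift: "third_class_lift U f F \<phi>" using f by (auto simp: third_class_def)
  note reg = third_class_lift_slice_regular [OF lift]
  show ?thesis
  proof (cases "U = {}")
    case True
    \<comment> \<open>Here the symmetry of the lift is vacuous and does not make \<open>\<phi>\<close> odd.\<close>
    then have "(slice_domain U :: 'a set) = {}" by (simp add: slice_domain_def)
    then show ?thesis
      using reg id_in_Aut_units by (intro exI [of _ "slice_fun U F"] exI [of _ id]) simp
  next
    case False
    then show ?thesis
      using reg lift third_class_liftD(3) [OF lift] third_class_lift_eq_slice_fun_Psi [OF lift U]
      by (intro exI [of _ "slice_fun U F"] exI [of _ \<phi>]) (auto simp: third_class_lift_def)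
  qed
qed

theorem proposition6p5:
  fixes U :: "complex set"
  assumes "compact (imag_units :: 'a::{real_algebra_1,euclidean_space} set)"
    and "connected (imag_units :: 'a set)"
    and "open U"
    and "cnj ` U = U"
  shows "(\<forall>(f :: 'a \<Rightarrow> 'a) F \<phi>. third_class_lift U f F \<phi> \<longrightarrow>
            slice_regular U (slice_fun U F) \<and>
            (\<forall>a\<in>slice_domain U. f a = (slice_fun U F \<circ> Psi U \<phi>) a))
       \<and> (\<forall>(g :: 'a \<Rightarrow> 'a) \<phi>. slice_regular U g \<and> \<phi> \<in> Aut_units \<and>
            (\<forall>s\<in>imag_units. \<phi> (- s) = - \<phi> s) \<longrightarrow>
            third_class U (g \<circ> Psi U \<phi>))
       \<and> {f :: 'a \<Rightarrow> 'a. third_class U f} =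
         {f. \<exists>g \<phi>. slice_regular U g \<and> \<phi> \<in> Aut_units \<and>
               (\<forall>s\<in>imag_units. \<phi> (- s) = - \<phi> s) \<and>
               (\<forall>a\<in>slice_domain U. f a = (g \<circ> Psi U \<phi>) a)}"
proof (intro conjI allI impI ballI)
  fix f :: "'a \<Rightarrow> 'a" and F \<phi>
  assume lift: "third_class_lift U f F \<phi>"
  show "slice_regular U (slice_fun U F :: 'a \<Rightarrow> 'a)"
    by (rule third_class_lift_slice_regular [OF lift])
  show "f a = (slice_fun U F \<circ> Psi U \<phi>) a" if "a \<in> slice_domain U" for a
    using third_class_lift_eq_slice_fun_Psi [OF lift assms(4) that] by simp
next
  fix g \<phi> :: "'a \<Rightarrow> 'a"
  assume "slice_regular U g \<and> \<phi> \<in> Aut_units \<and> (\<forall>s\<in>imag_units. \<phi> (- s) = - \<phi> s)"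
  then show "third_class U (g \<circ> Psi U \<phi>)"
    by (intro third_class_slice_regular_Psi [OF _ _ _ assms(4)]) auto
next
  show "{f :: 'a \<Rightarrow> 'a. third_class U f} =
      {f. \<exists>g \<phi>. slice_regular U g \<and> \<phi> \<in> Aut_units \<and>
        (\<forall>s\<in>imag_units. \<phi> (- s) = - \<phi> s) \<and>
        (\<forall>a\<in>slice_domain U. f a = (g \<circ> Psi U \<phi>) a)}"
    using third_class_imp_slice_regular_Psi [OF _ assms(4)]
      third_class_slice_regular_Psi [OF _ _ _ assms(4)]
    by (auto simp only: o_apply set_eq_iff mem_Collect_eq) blast+
qed

end
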